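(* Let $1\le p<\infty$ and let $q$ be the conjugate exponent of $p$ ($\frac1p+\frac1q=1$, $q=\infty$ if $p=1$). Let $A\in(\ell_p(\Delta^{(\tilde\alpha)}),\ell_1)$. Then $$\|A\|_{(\ell_p(\Delta^{(\tilde\alpha)}),\ell_1)}\le\|L_A\|\le4\cdot\|A\|_{(\ell_p(\Delta^{(\tilde\alpha)}),\ell_1)},$$ where $$\|A\|_{(\ell_p(\Delta^{(\tilde\alpha)}),\ell_1)}=\sup_{N\in\mathcal F}\Big(\sum_{k=0}^\infty\Big|\sum_{n\in N}\hat a_{nk}\Big|^q\Big)^{1/q}<\infty,$$ the inner expression being read as $\sup_k\big|\sum_{n\in N}\hat a_{nk}\big|$ when $p=1$.
   Context: $\omega$ is the set of all complex sequences $x=(x_k)_{k\ge0}$; $\ell_p$ carries its usual norm. Fix a fraction $\tilde\alpha$ (a real non-integer number). For $x\in\omega$ put $$(\Delta^{(\tilde\alpha)}x)_k=\sum_{i=0}^{k}(-1)^i\frac{\Gamma(\tilde\alpha+1)}{i!\,\Gamma(\tilde\alpha-i+1)}x_{k-i}$$ (terms with negative index are zero). Then $\ell_p(\Delta^{(\tilde\alpha)})=\{x\in\omega:\Delta^{(\tilde\alpha)}x\in\ell_p\}$, a Banach space with norm $\|x\|=\|\Delta^{(\tilde\alpha)}x\|_{\ell_p}$. For an infinite complex matrix $A=(a_{nk})_{n,k\ge0}$ and $X,Y\subset\omega$, $A\in(X,Y)$ means that for every $x\in X$ the series $A_nx=\sum_{k=0}^\infty a_{nk}x_k$ converges for all $n$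 and $Ax=(A_nx)_{n\ge0}\in Y$. $L_A:X\to Y$ denotes the (bounded) operator $L_A(x)=Ax$, and $\|L_A\|$ its operator norm. The matrix $\hat A=(\hat a_{nk})$ associated with $A$ is $$\hat a_{nk}=\sum_{j=k}^\infty(-1)^{j-k}\frac{\Gamma(-\tilde\alpha+1)}{(j-k)!\,\Gamma(-\tilde\alpha-j+k+1)}a_{nj}$$ (these series converge whenever $A$ maps $\ell_p(\Delta^{(\tilde\alpha)})$ into some subset of $\omega$). $\mathcal F$ is the collection of all nonempty finite subsets of $\{0,1,2,\dots\}$. *)

theory Defs
  imports "HOL-Analysis.Analysis"
begin

(* The exponent ranges over [1,\<infinity>], represented in ennreal. The norm takes values
   in [0,\<infinity>], with \<infinity> on sequences outside the space. *)
definition ell_norm :: "ennreal \<Rightarrow> (nat \<Rightarrow> complex) \<Rightarrow> ennreal" where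
  "ell_norm p x =
     (if p = \<infinity> then (SUP k. ennreal (cmod (x k)))
      else if summable (\<lambda>k. cmod (x k) powr enn2real p)
      then ennreal ((\<Sum>k. cmod (x k) powr enn2real p) powr (1 / enn2real p))
      else \<infinity>)"

definition ell :: "ennreal \<Rightarrow> (nat \<Rightarrow> complex) set" where
  "ell p = {x. ell_norm p x < \<infinity>}"

definition frac_coeff :: "real \<Rightarrow> nat \<Rightarrow> real" where
  "frac_coeff \<alpha> i = (-1) ^ i * (Gamma (\<alpha> + 1) / (fact i * Gamma (\<alpha> - real i + 1)))"

definition frac_diff :: "real \<Rightarrow> (nat \<Rightarrow> complex) \<Rightarrow> nat \<Rightarrow> complex" where
  "frac_diff \<alpha> x k = (\<Sum>i\<le>k. of_real (frac_coeff \<alpha> i) * x (k - i))"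

definition ell_diff :: "real \<Rightarrow> ennreal \<Rightarrow> (nat \<Rightarrow> complex) set" where
  "ell_diff \<alpha> p = {x. frac_diff \<alpha> x \<in> ell p}"

definition ell_diff_norm :: "real \<Rightarrow> ennreal \<Rightarrow> (nat \<Rightarrow> complex) \<Rightarrow> ennreal" where
  "ell_diff_norm \<alpha> p x = ell_norm p (frac_diff \<alpha> x)"

definition mat_app :: "(nat \<Rightarrow> nat \<Rightarrow> complex) \<Rightarrow> (nat \<Rightarrow> complex) \<Rightarrow> nat \<Rightarrow> complex" where
  "mat_app A x n = (\<Sum>k. A n k * x k)"

definition mat_class ::
    "(nat \<Rightarrow> complex) set \<Rightarrow> (nat \<Rightarrow> complex) set \<Rightarrow> (nat \<Rightarrow> nat \<Rightarrow> complex) set" where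
  "mat_class X Y =
     {A. \<forall>x\<in>X. (\<forall>n. summable (\<lambda>k. A n k * x k)) \<and> mat_app A x \<in> Y}"

(* As in the library's onorm, the supremum of the quotients of norms; it is \<infinity> exactly
   when the operator is unbounded. *)
definition op_norm ::
    "(nat \<Rightarrow> complex) set \<Rightarrow> ((nat \<Rightarrow> complex) \<Rightarrow> ennreal) \<Rightarrow> ((nat \<Rightarrow> complex) \<Rightarrow> ennreal)
      \<Rightarrow> ((nat \<Rightarrow> complex) \<Rightarrow> (nat \<Rightarrow> complex)) \<Rightarrow> ennreal" where
  "op_norm X normX normY L = (SUP x\<in>X - {\<lambda>_. 0}. normY (L x) / normX x)"

(* The summation index is i = j - k, where j \<ge> k is the column index of A. The series
   converges whenever A is in mat_class (ell_diff \<alpha> p) Y for some Y (test A on the sequence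
   whose difference is the k-th unit sequence). *)
definition hat_mat :: "real \<Rightarrow> (nat \<Rightarrow> nat \<Rightarrow> complex) \<Rightarrow> nat \<Rightarrow> nat \<Rightarrow> complex" where
  "hat_mat \<alpha> A n k = (\<Sum>i. of_real (frac_coeff (- \<alpha>) i) * A n (k + i))"

(* For q = \<infinity>, ell_norm is the supremum over the columns k. *)
definition diff_mat_norm :: "real \<Rightarrow> ennreal \<Rightarrow> (nat \<Rightarrow> nat \<Rightarrow> complex) \<Rightarrow> ennreal" where
  "diff_mat_norm \<alpha> q A =
     (SUP N\<in>{N. finite N \<and> N \<noteq> {}}. ell_norm q (\<lambda>k. \<Sum>n\<in>N. hat_mat \<alpha> A n k))"

end

theory Submission
  imports Defs
begin

text \<open>By the Vandermonde identity the operators of orders \<open>\<alpha>\<close> and \<open>- \<alpha>\<close> are mutually inverse, so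
  \<open>x\<close> may be replaced by \<open>y = frac_diff \<alpha> x\<close> in the unit ball of \<open>\<ell>\<^sub>p\<close>. The functional taking
  \<open>y\<close> to the sum of \<open>mat_app A x n\<close> over \<open>n \<in> N\<close> is continuous as a pointwise limit of
  continuous functionals, its value at the \<open>k\<close>-th unit sequence is the sum of \<open>hat_mat \<alpha> A n k\<close>
  over \<open>n \<in> N\<close>, and hence its norm is the \<open>\<ell>\<^sub>q\<close> norm of that sequence of sums. As its absolute
  value is at most the \<open>\<ell>\<^sub>1\<close> norm of \<open>mat_app A x\<close>, uniform boundedness gives finiteness
  and the lower estimate follows. For the upper one, splitting into positive and negative real and
  imaginary parts bounds an \<open>\<ell>\<^sub>1\<close> norm by four times the largest modulus of a finite subsum.\<close>

section \<open>The unit ball of the sequence space\<close>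

text \<open>Convexity of \<open>powr p\<close> for weights whose sum \<open>s\<close> may fall short
  of one: normalize the weights and use \<open>s powr p \<le> s\<close>. This does the work of
  Minkowski's inequality below.\<close>

lemma powr_subconvex:
  fixes a b u v p :: real
  assumes "1 \<le> p" "0 \<le> a" "0 \<le> b" "a + b \<le> 1" "0 \<le> u" "0 \<le> v"
  shows "(a * u + b * v) powr p \<le> a * u powr p + b * v powr p"
proof -
  have le_self: "t powr p \<le> t" if "0 \<le> t" "t \<le> 1" for t
    using powr_mono'[of 1 p t] that assms(1) by simp
  have one: "(c * w) powr p \<le> c * w powr p" if "0 \<le> c" "c \<le> 1" "0 \<le> w" for c w
    using le_self[of c] that by (simp add: powr_mult mult_right_mono)
  \<comment> \<open>The degenerate cases are split off because convexity is applied at positive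
    arguments and the weights get divided by their sum.\<close>
  consider "u = 0" | "v = 0" | "a + b = 0" | "u > 0" "v > 0" "a + b > 0"
    using assms by linarith
  then show ?thesis
  proof cases
    case 1
    then show ?thesis using one[of b v] assms by simp
  next
    case 2
    then show ?thesis using one[of a u] assms by simp
  next
    case 3
    then have "a = 0" "b = 0" using assms by linarith+
    then show ?thesis by simp
  next
    case 4
    define s where "s = a + b"
    have s: "s > 0" "s \<le> 1" using 4 assms by (auto simp: s_def)
    define t where "t = b / s"
    have t: "0 \<le> t" "t \<le> 1" "(1 - t) * s = a" "t * s = b"
      using s assms by (auto simp: t_def s_def field_simps)
    have eq: "a * u + b * v = s * ((1 - t) * u + t * v)"
      unfolding t(3,4)[symmetric] by (simp add: algebra_simps)
    have "(a * u + b * v) powr p \<le> s * ((1 - t) * u + t * v) powr p"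
      unfolding eq by (rule one) (use s t assms in auto)
    also have "((1 - t) * u + t * v) powr p \<le> (1 - t) * u powr p + t * v powr p"
      using convex_onD[OF powr_convex[OF assms(1)], of t u v] t 4 by simp
    then have "s * ((1 - t) * u + t * v) powr p \<le> s * ((1 - t) * u powr p + t * v powr p)"
      using s by (intro mult_left_mono) auto
    also have "\<dots> = a * u powr p + b * v powr p"
      unfolding t(3,4)[symmetric] by (simp add: algebra_simps)
    finally show ?thesis .
  qed
qed

text \<open>Bounded partial sums of nonnegative terms force summability, which rules out the default
  value infinity of \<open>ell_norm\<close>. Norm bounds thereby become statements about finite
  sums.\<close>

lemma ell_norm_le_iff:
  assumes "0 < p" "0 \<le> c"
  shows "ell_norm (ennreal p) y \<le> ennreal c
    \<longleftrightarrow> (\<forall>K. (\<Sum>k<K. cmod (y k) powr p) \<le> c powr p)"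
proof -
  let ?f = "\<lambda>k. cmod (y k) powr p"
  have root: "S powr (1 / p) \<le> c \<longleftrightarrow> S \<le> c powr p" if "0 \<le> S" for S
  proof
    assume "S powr (1 / p) \<le> c"
    then have "(S powr (1 / p)) powr p \<le> c powr p"
      using assms by (intro powr_mono2) auto
    then show "S \<le> c powr p" using assms that by (simp add: powr_powr)
  next
    assume "S \<le> c powr p"
    then have "S powr (1 / p) \<le> (c powr p) powr (1 / p)"
      using assms that by (intro powr_mono2) auto
    then show "S powr (1 / p) \<le> c" using assms by (simp add: powr_powr)
  qed
  have "(\<forall>K. sum ?f {..<K} \<le> c powr p) \<longleftrightarrow> summable ?f \<and> suminf ?f \<le> c powr p"
  proof safe
    assume *: "\<forall>K. sum ?f {..<K} \<le> c powr p"
    then show "summable ?f" by (intro summableI_nonneg_bounded) auto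
    then show "suminf ?f \<le> c powr p" using * by (intro suminf_le_const) auto
  next
    fix K
    assume "summable ?f" "suminf ?f \<le> c powr p"
    then show "sum ?f {..<K} \<le> c powr p"
      using sum_le_suminf[of ?f "{..<K}"] by simp
  qed
  moreover have "ell_norm (ennreal p) y \<le> ennreal c \<longleftrightarrow> summable ?f \<and> suminf ?f \<le> c powr p"
    using assms root[OF suminf_nonneg, of ?f]
    by (auto simp: ell_norm_def top_unique)
  ultimately show ?thesis by simp
qed

definition lp_ball :: "real \<Rightarrow> (nat \<Rightarrow> complex) set" where
  "lp_ball p = {y. ell_norm (ennreal p) y \<le> 1}"

lemma lp_ball_iff: "0 < p \<Longrightarrow> y \<in> lp_ball p \<longleftrightarrow> (\<forall>K. (\<Sum>k<K. cmod (y k) powr p) \<le> 1)"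
  using ell_norm_le_iff[of p 1 y] by (simp add: lp_ball_def)

lemma ell_norm_le_iff_scaled:
  assumes "0 < p" "0 < c"
  shows "ell_norm (ennreal p) y \<le> ennreal c \<longleftrightarrow> (\<lambda>k. y k / of_real c) \<in> lp_ball p"
  using assms
  by (simp add: ell_norm_le_iff lp_ball_iff norm_divide powr_divide flip: sum_divide_distrib)

lemma lp_ball_norm_le:
  assumes "0 < p" "y \<in> lp_ball p"
  shows "cmod (y k) \<le> 1"
proof -
  have "cmod (y k) powr p \<le> (\<Sum>k<Suc k. cmod (y k) powr p)"
    by (intro member_le_sum) auto
  also have "\<dots> \<le> 1" using assms lp_ball_iff by blast
  finally show ?thesis
    using assms(1)
    by (metis less_eq_real_def norm_ge_zero not_le powr_less_mono2 powr_one_eq_one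
        zero_less_one_class.zero_le_one)
qed

text \<open>Absolute convexity of the ball, by \<open>powr_subconvex\<close> in each coordinate; it
  replaces the triangle inequality for the norm.\<close>

lemma lp_ball_comb:
  assumes "1 \<le> p" "x \<in> lp_ball p" "y \<in> lp_ball p" "cmod a + cmod b \<le> 1"
  shows "(\<lambda>k. a * x k + b * y k) \<in> lp_ball p"
proof -
  have p: "0 < p" using assms by simp
  have "(\<Sum>k<K. cmod (a * x k + b * y k) powr p) \<le> 1" for K
  proof -
    have "(\<Sum>k<K. cmod (a * x k + b * y k) powr p)
        \<le> (\<Sum>k<K. cmod a * cmod (x k) powr p + cmod b * cmod (y k) powr p)"
    proof (intro sum_mono)
      fix k
      have "cmod (a * x k + b * y k) \<le> cmod a * cmod (x k) + cmod b * cmod (y k)"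
        by (metis norm_mult norm_triangle_ineq)
      then have "cmod (a * x k + b * y k) powr p
          \<le> (cmod a * cmod (x k) + cmod b * cmod (y k)) powr p"
        using p by (intro powr_mono2) auto
      also have "\<dots> \<le> cmod a * cmod (x k) powr p + cmod b * cmod (y k) powr p"
        using assms by (intro powr_subconvex) auto
      finally show "cmod (a * x k + b * y k) powr p
          \<le> cmod a * cmod (x k) powr p + cmod b * cmod (y k) powr p" .
    qed
    also have "\<dots> = cmod a * (\<Sum>k<K. cmod (x k) powr p) + cmod b * (\<Sum>k<K. cmod (y k) powr p)"
      by (simp add: sum.distrib sum_distrib_left)
    also have "\<dots> \<le> cmod a * 1 + cmod b * 1"
      using assms lp_ball_iff[OF p] by (intro add_mono mult_left_mono) auto
    finally show ?thesis using assms by simp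
  qed
  then show ?thesis using p by (simp add: lp_ball_iff)
qed

lemma lp_ball_scale:
  assumes "1 \<le> p" "x \<in> lp_ball p" "cmod a \<le> 1"
  shows "(\<lambda>k. a * x k) \<in> lp_ball p"
  using lp_ball_comb[of p x x a 0] assms by simp

lemma lp_ball_mono:
  assumes "0 < p" "x \<in> lp_ball p" "\<And>k. cmod (y k) \<le> cmod (x k)"
  shows "y \<in> lp_ball p"
proof -
  have "(\<Sum>k<K. cmod (y k) powr p) \<le> (\<Sum>k<K. cmod (x k) powr p)" for K
    using assms by (intro sum_mono powr_mono2) auto
  then show ?thesis
    using assms(2) unfolding lp_ball_iff[OF assms(1)] by (blast intro: order_trans)
qed

text \<open>Each defining inequality involves finitely many coordinates, so coordinatewise
  convergence suffices.\<close>

lemma lp_ball_LIMSEQ: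
  assumes "0 < p" "\<And>n. u n \<in> lp_ball p" "\<And>k. (\<lambda>n. u n k) \<longlonglongrightarrow> y k"
  shows "y \<in> lp_ball p"
proof -
  have "(\<Sum>k<K. cmod (y k) powr p) \<le> 1" for K
  proof (rule LIMSEQ_le_const2)
    show "(\<lambda>n. \<Sum>k<K. cmod (u n k) powr p) \<longlonglongrightarrow> (\<Sum>k<K. cmod (y k) powr p)"
      using assms by (intro tendsto_sum tendsto_powr2 tendsto_norm tendsto_const) auto
    show "\<exists>N. \<forall>n\<ge>N. (\<Sum>k<K. cmod (u n k) powr p) \<le> 1"
      using assms lp_ball_iff by blast
  qed
  then show ?thesis using assms by (simp add: lp_ball_iff)
qed

lemma in_ell_iff_scaled_ball:
  assumes "0 < p"
  shows "y \<in> ell (ennreal p) \<longleftrightarrow> (\<exists>c>0. \<exists>u\<in>lp_ball p. y = (\<lambda>k. of_real c * u k))"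
proof
  assume "y \<in> ell (ennreal p)"
  then have "ell_norm (ennreal p) y < \<infinity>" by (simp add: ell_def)
  then obtain r where r: "0 \<le> r" "ell_norm (ennreal p) y = ennreal r"
    by (cases "ell_norm (ennreal p) y") auto
  \<comment> \<open>\<open>r + 1\<close> instead of \<open>r\<close> keeps the scaling factor
    positive when the norm is zero.\<close>
  then have "ell_norm (ennreal p) y \<le> ennreal (r + 1)"
    by simp
  then have "(\<lambda>k. y k / of_real (r + 1)) \<in> lp_ball p"
    using ell_norm_le_iff_scaled[OF assms, of "r + 1" y] r by simp
  moreover have "of_real (r + 1) \<noteq> (0 :: complex)"
    using r(1) by (simp only: of_real_eq_0_iff)
  then have "y = (\<lambda>k. of_real (r + 1) * (y k / of_real (r + 1)))"
    by (simp del: of_real_add)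
  ultimately show "\<exists>c>0. \<exists>u\<in>lp_ball p. y = (\<lambda>k. of_real c * u k)"
    using r(1) by (intro exI[of _ "r + 1"] conjI bexI[of _ "\<lambda>k. y k / of_real (r + 1)"]) auto
next
  assume "\<exists>c>0. \<exists>u\<in>lp_ball p. y = (\<lambda>k. of_real c * u k)"
  then obtain c u where "0 < c" "u \<in> lp_ball p" "y = (\<lambda>k. of_real c * u k)" by blast
  then have "ell_norm (ennreal p) y \<le> ennreal c"
    using assms by (simp add: ell_norm_le_iff_scaled)
  then show "y \<in> ell (ennreal p)"
    by (simp add: ell_def order_le_less_trans)
qed

lemma lp_ball_in_ell: "y \<in> lp_ball p \<Longrightarrow> y \<in> ell (ennreal p)"
  by (auto simp: lp_ball_def ell_def intro: order_le_less_trans)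

lemma ell_comb:
  assumes "1 \<le> p" "x \<in> ell (ennreal p)" "y \<in> ell (ennreal p)"
  shows "(\<lambda>k. a * x k + b * y k) \<in> ell (ennreal p)"
proof -
  have p: "0 < p" using assms by simp
  obtain c u d v where c: "0 < c" "u \<in> lp_ball p" "x = (\<lambda>k. of_real c * u k)"
    and d: "0 < d" "v \<in> lp_ball p" "y = (\<lambda>k. of_real d * v k)"
    using assms in_ell_iff_scaled_ball[OF p] by meson
  \<comment> \<open>Dividing by \<open>s\<close> brings the sum of the absolute coefficients to at
    most one; the summand 1 keeps \<open>s\<close> positive when \<open>a\<close> and
    \<open>b\<close> vanish.\<close>
  define s where "s = cmod a * c + cmod b * d + 1"
  have s: "s > 0" using c d by (simp add: s_def add_nonneg_pos)
  have "(\<lambda>k. (a * of_real c / of_real s) * u k + (b * of_real d / of_real s) * v k) \<in> lp_ball p"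
  proof (rule lp_ball_comb)
    show "cmod (a * of_real c / of_real s) + cmod (b * of_real d / of_real s) \<le> 1"
      using c d s by (simp add: norm_mult norm_divide divide_simps) (simp add: s_def)
  qed (use c d assms in auto)
  moreover have "(\<lambda>k. a * x k + b * y k) = (\<lambda>k. of_real s *
      ((a * of_real c / of_real s) * u k + (b * of_real d / of_real s) * v k))"
    using s by (auto simp: c d field_simps)
  ultimately show ?thesis
    unfolding in_ell_iff_scaled_ball[OF p] using s by (intro exI[of _ s] conjI bexI)
qed

text \<open>The weights sum to one, so this says that the unit ball is closed under a countable convex
  combination.\<close>
lemma lp_ball_geometric:
  fixes v :: "nat \<Rightarrow> nat \<Rightarrow> complex"
  assumes p: "1 \<le> p" and v: "\<And>n. v n \<in> lp_ball p"
  shows "summable (\<lambda>j. (2/3) * (1/3) ^ j * v j k)"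
    and "(\<lambda>k. \<Sum>j. (2/3) * (1/3) ^ j * v j k) \<in> lp_ball p"
proof -
  have summ: "summable (\<lambda>j. (2/3) * (1/3) ^ j * v j k)" for k
  proof (rule summable_comparison_test)
    show "summable (\<lambda>j. (1/3) ^ j :: real)" by (intro summable_geometric) auto
    show "\<exists>N. \<forall>n\<ge>N. cmod ((2/3) * (1/3) ^ n * v n k) \<le> (1/3) ^ n"
    proof (intro exI allI impI)
      fix n :: nat
      have "cmod (v n k) \<le> 1" using lp_ball_norm_le[of p "v n" k] p v by simp
      then have "(2/3) * (1/3) ^ n * cmod (v n k) \<le> (2/3) * (1/3) ^ n * 1"
        by (intro mult_left_mono) auto
      also have "\<dots> \<le> (1/3) ^ n" by simp
      finally show "cmod ((2/3) * (1/3) ^ n * v n k) \<le> (1/3) ^ n"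
        by (simp add: norm_mult norm_power norm_divide)
    qed
  qed
  show "summable (\<lambda>j. (2/3) * (1/3) ^ j * v j k)" by (rule summ)
  \<comment> \<open>Peeling off the first term leaves a third of a sum of the same shape for the
    shifted sequence, and 2/3 + 1/3 = 1; hence the induction for all shifts
    \<open>n\<close>.\<close>
  have fin: "(\<lambda>k. \<Sum>j<J. (2/3) * (1/3) ^ j * v (n + j) k) \<in> lp_ball p" for J n
  proof (induction J arbitrary: n)
    case 0
    then show ?case using p by (simp add: lp_ball_iff)
  next
    case (Suc J)
    have "(\<lambda>k. (2/3) * v n k + (1/3) * (\<Sum>j<J. (2/3) * (1/3) ^ j * v (Suc n + j) k)) \<in> lp_ball p"
      using p by (intro lp_ball_comb v Suc.IH) (auto simp: norm_divide)
    then show ?case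
      by (simp add: sum.lessThan_Suc_shift sum_distrib_left mult_ac del: sum.lessThan_Suc)
  qed
  show "(\<lambda>k. \<Sum>j. (2/3) * (1/3) ^ j * v j k) \<in> lp_ball p"
  proof (rule lp_ball_LIMSEQ)
    show "(\<lambda>k. \<Sum>j<J. (2/3) * (1/3) ^ j * v j k) \<in> lp_ball p" for J
      using fin[where n = 0] by simp
    show "(\<lambda>J. \<Sum>j<J. (2/3) * (1/3) ^ j * v j k) \<longlonglongrightarrow> (\<Sum>j. (2/3) * (1/3) ^ j * v j k)" for k
      using summ summable_LIMSEQ by blast
  qed (use p in auto)
qed

section \<open>Continuous functionals and uniform boundedness\<close>

text \<open>Linearity is asked for on the space only, since functionals given by infinite series
  have meaningless values elsewhere.\<close>

definition lp_functional :: "real \<Rightarrow> ((nat \<Rightarrow> complex) \<Rightarrow> complex) \<Rightarrow> bool" where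
  "lp_functional p T \<longleftrightarrow>
    (\<forall>x\<in>ell (ennreal p). \<forall>y\<in>ell (ennreal p). \<forall>a b.
        T (\<lambda>k. a * x k + b * y k) = a * T x + b * T y)
    \<and> (\<exists>C. \<forall>y\<in>lp_ball p. cmod (T y) \<le> C)"

lemma lp_functional_comb:
  "\<lbrakk>lp_functional p T; x \<in> ell (ennreal p); y \<in> ell (ennreal p)\<rbrakk>
    \<Longrightarrow> T (\<lambda>k. a * x k + b * y k) = a * T x + b * T y"
  unfolding lp_functional_def by blast

lemma lp_functional_scale:
  assumes "lp_functional p T" "x \<in> ell (ennreal p)"
  shows "T (\<lambda>k. a * x k) = a * T x"
  using lp_functional_comb[OF assms assms(2), of a 0] by simp

lemma lp_functional_coord: "0 < p \<Longrightarrow> lp_functional p (\<lambda>y. y k)"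
  by (auto simp: lp_functional_def intro!: exI[of _ 1] lp_ball_norm_le)

lemma lp_functional_cmult:
  assumes "lp_functional p T"
  shows "lp_functional p (\<lambda>y. c * T y)"
  unfolding lp_functional_def
proof (intro conjI ballI allI)
  fix x y a b
  assume "x \<in> ell (ennreal p)" "y \<in> ell (ennreal p)"
  then show "c * T (\<lambda>k. a * x k + b * y k) = a * (c * T x) + b * (c * T y)"
    by (subst lp_functional_comb[OF assms]) (auto simp: algebra_simps)
next
  obtain C where C: "\<forall>y\<in>lp_ball p. cmod (T y) \<le> C"
    using assms unfolding lp_functional_def by blast
  have "cmod (c * T y) \<le> cmod c * C" if "y \<in> lp_ball p" for y
    using C that by (simp add: norm_mult mult_left_mono)
  then show "\<exists>C. \<forall>y\<in>lp_ball p. cmod (c * T y) \<le> C" by blast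
qed

lemma lp_functional_sum:
  assumes "\<And>n. n \<in> N \<Longrightarrow> lp_functional p (T n)"
  shows "lp_functional p (\<lambda>y. \<Sum>n\<in>N. T n y)"
  unfolding lp_functional_def
proof (intro conjI ballI allI)
  fix x y a b
  assume "x \<in> ell (ennreal p)" "y \<in> ell (ennreal p)"
  then have "(\<Sum>n\<in>N. T n (\<lambda>k. a * x k + b * y k)) = (\<Sum>n\<in>N. a * T n x + b * T n y)"
    using assms by (intro sum.cong lp_functional_comb) auto
  then show "(\<Sum>n\<in>N. T n (\<lambda>k. a * x k + b * y k)) = a * (\<Sum>n\<in>N. T n x) + b * (\<Sum>n\<in>N. T n y)"
    by (simp add: sum.distrib sum_distrib_left)
next
  have "\<forall>n\<in>N. \<exists>C. \<forall>y\<in>lp_ball p. cmod (T n y) \<le> C"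
    using assms unfolding lp_functional_def by blast
  then obtain C where C: "\<forall>n\<in>N. \<forall>y\<in>lp_ball p. cmod (T n y) \<le> C n"
    by metis
  have "cmod (\<Sum>n\<in>N. T n y) \<le> (\<Sum>n\<in>N. C n)" if "y \<in> lp_ball p" for y
    using C that by (intro sum_norm_le) auto
  then show "\<exists>C. \<forall>y\<in>lp_ball p. cmod (\<Sum>n\<in>N. T n y) \<le> C" by blast
qed

text \<open>Sokal's gliding hump: whatever the partial sum \<open>s n\<close> is, one of the two steps
  \<open>s n \<plusminus> u n / 3 ^ n\<close> makes the \<open>n\<close>-th functional large, and the remaining steps
  are too small to undo this.\<close>
theorem lp_uniform_boundedness:
  assumes p: "1 \<le> p"
    and F: "\<And>i. i \<in> I \<Longrightarrow> lp_functional p (T i)"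
    and pointwise: "\<And>y. y \<in> lp_ball p \<Longrightarrow> \<exists>C. \<forall>i\<in>I. cmod (T i y) \<le> C"
  shows "\<exists>C. \<forall>i\<in>I. \<forall>y\<in>lp_ball p. cmod (T i y) \<le> C"
proof (rule ccontr)
  assume unbounded: "\<not> ?thesis"
  have ball_ell: "x \<in> ell (ennreal p)" if "x \<in> lp_ball p" for x
    using that by (rule lp_ball_in_ell)
  \<comment> \<open>\<open>C\<close> is the norm of the chosen functional, at least
    \<open>4 ^ n\<close> by unboundedness, and \<open>u\<close> attains three quarters of
    it.\<close>
  have "\<exists>i u C. i \<in> I \<and> u \<in> lp_ball p \<and> (\<forall>y\<in>lp_ball p. cmod (T i y) \<le> C)
      \<and> 3 / 4 * C \<le> cmod (T i u) \<and> 4 ^ n \<le> C" for n :: nat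
  proof -
    obtain i y where i: "i \<in> I" and y: "y \<in> lp_ball p" "4 ^ n < cmod (T i y)"
      using unbounded by (meson not_le)
    define C where "C = (SUP y\<in>lp_ball p. cmod (T i y))"
    have bdd: "bdd_above ((\<lambda>y. cmod (T i y)) ` lp_ball p)"
      using F[OF i] unfolding lp_functional_def bdd_above_def by blast
    have upper: "cmod (T i z) \<le> C" if "z \<in> lp_ball p" for z
      unfolding C_def using that bdd by (rule cSUP_upper)
    have "4 ^ n \<le> C" using upper[OF y(1)] y(2) by simp
    moreover have "0 < C" using calculation by (smt (verit) zero_less_power)
    then have "3 / 4 * C < C" by simp
    then obtain u where "u \<in> lp_ball p" "3 / 4 * C < cmod (T i u)"
      using less_cSUP_iff[OF _ bdd] y(1) unfolding C_def by blast
    ultimately show ?thesis using i upper by (meson less_imp_le)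
  qed
  then obtain i u C where i: "\<And>n. i n \<in> I" and u: "\<And>n. u n \<in> lp_ball p"
    and C: "\<And>n y. y \<in> lp_ball p \<Longrightarrow> cmod (T (i n) y) \<le> C n"
    and large: "\<And>n. 3 / 4 * C n \<le> cmod (T (i n) (u n))" "\<And>n. 4 ^ n \<le> C n"
    by metis
  let ?step = "\<lambda>n x e. \<lambda>k. 1 * x k + (e / 3 ^ n) * u n k"
  have "\<exists>s. \<forall>n. (s n \<in> ell (ennreal p) \<and> (n = 0 \<longrightarrow> s n = (\<lambda>_. 0))) \<and>
    (\<exists>e. cmod e = 1 \<and> s (Suc n) = ?step n (s n) e
       \<and> cmod (T (i n) (u n)) / 3 ^ n \<le> cmod (T (i n) (s (Suc n))))"
  proof (rule dependent_nat_choice)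
    have "(\<lambda>_. 0) \<in> ell (ennreal p)"
      using ell_comb[OF p ball_ell[OF u] ball_ell[OF u], of 0 0 0 0] by simp
    then show "\<exists>x. x \<in> ell (ennreal p) \<and> (0 = (0::nat) \<longrightarrow> x = (\<lambda>_. 0))"
      by blast
  next
    fix x :: "nat \<Rightarrow> complex" and n :: nat
    assume "x \<in> ell (ennreal p) \<and> (n = 0 \<longrightarrow> x = (\<lambda>_. 0))"
    then have x: "x \<in> ell (ennreal p)" by simp
    have T_step: "T (i n) (?step n x e) = T (i n) x + e / 3 ^ n * T (i n) (u n)" for e
      using lp_functional_comb[OF F[OF i] x ball_ell[OF u], of n 1 "e / 3 ^ n"] by simp
    let ?a = "T (i n) x" and ?b = "T (i n) (u n) / 3 ^ n"
    \<comment> \<open>Twice \<open>?b\<close> is the difference of \<open>?a + ?b\<close> and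
      \<open>?a - ?b\<close>, so one of these has modulus at least \<open>cmod ?b\<close>.\<close>
    have "2 * cmod ?b \<le> cmod (?a + ?b) + cmod (?a - ?b)"
      using norm_triangle_ineq4[of "?a + ?b" "?a - ?b"]
      by (simp flip: mult_2 add: norm_mult norm_divide norm_power)
    then have "cmod ?b \<le> cmod (?a + ?b) \<or> cmod ?b \<le> cmod (?a - ?b)"
      by linarith
    then have "\<exists>e. cmod e = 1 \<and> cmod ?b \<le> cmod (?a + e / 3 ^ n * T (i n) (u n))"
    proof
      assume "cmod ?b \<le> cmod (?a + ?b)"
      then show ?thesis by (intro exI[of _ 1]) simp
    next
      assume "cmod ?b \<le> cmod (?a - ?b)"
      then show ?thesis by (intro exI[of _ "-1"]) simp
    qed
    then obtain e where e: "cmod e = 1"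
      "cmod ?b \<le> cmod (?a + e / 3 ^ n * T (i n) (u n))" by blast
    show "\<exists>y. (y \<in> ell (ennreal p) \<and> (Suc n = 0 \<longrightarrow> y = (\<lambda>_. 0))) \<and>
        (\<exists>e. cmod e = 1 \<and> y = ?step n x e
          \<and> cmod (T (i n) (u n)) / 3 ^ n \<le> cmod (T (i n) y))"
    proof (intro exI[of _ "?step n x e"] conjI exI[of _ e])
      show "?step n x e \<in> ell (ennreal p)"
        by (intro ell_comb p x ball_ell u)
      show "cmod (T (i n) (u n)) / 3 ^ n \<le> cmod (T (i n) (?step n x e))"
        using e(2) unfolding T_step by (simp add: norm_divide norm_power)
    qed (use e in auto)
  qed
  then obtain s where s: "\<forall>n. (s n \<in> ell (ennreal p) \<and> (n = 0 \<longrightarrow> s n = (\<lambda>_. 0))) \<and>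
    (\<exists>e. cmod e = 1 \<and> s (Suc n) = ?step n (s n) e
       \<and> cmod (T (i n) (u n)) / 3 ^ n \<le> cmod (T (i n) (s (Suc n))))" ..
  then have s_ell: "s n \<in> ell (ennreal p)" for n by blast
  have s0: "s 0 = (\<lambda>_. 0)" using s by blast
  have "\<forall>n. \<exists>e. cmod e = 1 \<and> s (Suc n) = ?step n (s n) e
       \<and> cmod (T (i n) (u n)) / 3 ^ n \<le> cmod (T (i n) (s (Suc n)))"
    using s by blast
  from choice[OF this] obtain e where e_all: "\<forall>n. cmod (e n) = 1 \<and> s (Suc n) = ?step n (s n) (e n)
       \<and> cmod (T (i n) (u n)) / 3 ^ n \<le> cmod (T (i n) (s (Suc n)))" ..
  then have e: "cmod (e n) = 1" and s_Suc: "s (Suc n) = ?step n (s n) (e n)"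
    and s_large: "cmod (T (i n) (u n)) / 3 ^ n \<le> cmod (T (i n) (s (Suc n)))" for n
    by blast+
  define v where "v = (\<lambda>n k. e n * u n k)"
  have v: "v n \<in> lp_ball p" for n
    unfolding v_def using e by (intro lp_ball_scale p u) simp
  \<comment> \<open>\<open>z n\<close> is the rescaled tail of the signed steps from
    \<open>n\<close> on; its weights sum to one, so it stays in the ball. The point refuting
    pointwise boundedness is \<open>z 0\<close>, two thirds of the limit of
    \<open>s\<close>.\<close>
  define z where "z = (\<lambda>n k. \<Sum>j. (2/3) * (1/3) ^ j * v (n + j) k)"
  have z: "z n \<in> lp_ball p" for n
    unfolding z_def by (rule lp_ball_geometric(2)[OF p]) (rule v)
  have z_Suc: "z n k = (2/3) * v n k + (1/3) * z (Suc n) k" for n k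
  proof -
    have summ: "summable (\<lambda>j. (2/3) * (1/3) ^ j * v (m + j) k)" for m
      by (rule lp_ball_geometric(1)[OF p]) (rule v)
    have "z n k = (\<Sum>j. (2/3) * (1/3) ^ Suc j * v (n + Suc j) k) + (2/3) * v n k"
      using suminf_split_head[OF summ[of n]] by (simp add: z_def)
    also have "(\<Sum>j. (2/3) * (1/3) ^ Suc j * v (n + Suc j) k)
        = (\<Sum>j. (1/3) * ((2/3) * (1/3) ^ j * v (Suc n + j) k))"
      by simp
    also have "\<dots> = (1/3) * z (Suc n) k"
      unfolding z_def by (rule suminf_mult[OF summ])
    finally show ?thesis by simp
  qed
  have s_eq: "s n k = (3/2) * (z 0 k - z n k / 3 ^ n)" for n k
  proof (induction n)
    case (Suc n)
    show ?case unfolding s_Suc Suc z_Suc[of n] v_def by (simp add: field_simps)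
  qed (simp add: s0)
  have z0: "z 0 = (\<lambda>k. (2/3) * s (Suc n) k + (1 / 3 ^ Suc n) * z (Suc n) k)" for n
    by (rule ext) (simp only: s_eq, simp add: field_simps)
  obtain D where D: "\<And>j. j \<in> I \<Longrightarrow> cmod (T j (z 0)) \<le> D"
    using pointwise[OF z] by blast
  \<comment> \<open>In units of \<open>C n / 3 ^ n\<close>, the part from \<open>s (Suc n)\<close>
    contributes at least 2/3 * 3/4 = 1/2 and the tail at most 1/3, which leaves 1/6; then
    \<open>C n\<close> is at least \<open>4 ^ n\<close>.\<close>
  have D_large: "(4/3) ^ n / 6 \<le> D" for n :: nat
  proof -
    have "(2/3) * (3 / 4 * C n / 3 ^ n) \<le> (2/3) * cmod (T (i n) (s (Suc n)))"
      using s_large[of n] divide_right_mono[OF large(1)[of n], of "3 ^ n"] by auto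
    moreover have "cmod (T (i n) (z (Suc n))) / 3 ^ Suc n \<le> C n / 3 ^ Suc n"
      using C[OF z] by (intro divide_right_mono) auto
    moreover have "T (i n) (z 0)
        = (2/3) * T (i n) (s (Suc n)) + (1 / 3 ^ Suc n) * T (i n) (z (Suc n))"
      by (subst z0[of n], rule lp_functional_comb[OF F[OF i]]) (auto intro: s_ell ball_ell z)
    then have "(2/3) * cmod (T (i n) (s (Suc n))) - cmod (T (i n) (z (Suc n))) / 3 ^ Suc n
        \<le> cmod (T (i n) (z 0))"
      using norm_diff_ineq[of "(2/3) * T (i n) (s (Suc n))" "(1 / 3 ^ Suc n) * T (i n) (z (Suc n))"]
      by (simp add: norm_mult norm_divide norm_power)
    ultimately have "C n / 3 ^ n / 6 \<le> D"
      using D[OF i[of n]] by simp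
    moreover have "(4/3) ^ n / 6 \<le> C n / 3 ^ n / (6::real)"
      using large(2)[of n] by (simp add: power_divide divide_right_mono)
    ultimately show ?thesis by linarith
  qed
  obtain n where "6 * D < (4/3 :: real) ^ n"
    using real_arch_pow[of "4/3" "6 * D"] by auto
  then show False using D_large[of n] by simp
qed

text \<open>Since p is finite, late tails of \<open>y\<close> lie in arbitrarily small multiples of
  the ball, where the functional is small.\<close>

lemma lp_functional_trunc_LIMSEQ:
  assumes p: "1 \<le> p" and T: "lp_functional p T" and y: "y \<in> ell (ennreal p)"
  shows "(\<lambda>K. T (\<lambda>k. if k < K then y k else 0)) \<longlonglongrightarrow> T y"
proof -
  let ?t = "\<lambda>K k. if k < K then y k else 0"
  have p0: "0 < p" using p by simp
  obtain C where C: "\<And>z. z \<in> lp_ball p \<Longrightarrow> cmod (T z) \<le> C"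
    using T unfolding lp_functional_def by blast
  have summ: "summable (\<lambda>k. cmod (y k) powr p)"
    using y p0 by (auto simp: ell_def ell_norm_def split: if_splits)
  have "\<exists>K0. \<forall>K\<ge>K0. dist (T (?t K)) (T y) < r" if "0 < r" for r
  proof -
    \<comment> \<open>Adding 1 avoids division by zero and makes the final estimate strict.\<close>
    define \<epsilon> where "\<epsilon> = r / (\<bar>C\<bar> + 1)"
    have \<epsilon>: "0 < \<epsilon>" using that by (simp add: \<epsilon>_def)
    obtain K0 where K0: "\<And>m n. m \<ge> K0 \<Longrightarrow> norm (\<Sum>k=m..<n. cmod (y k) powr p) < \<epsilon> powr p"
      using summ \<epsilon> unfolding summable_Cauchy by (metis powr_gt_zero less_irrefl)
    have "dist (T (?t K)) (T y) < r" if K: "K \<ge> K0" for K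
    proof -
      let ?w = "\<lambda>k. if k < K then 0 else y k / of_real \<epsilon>"
      have w: "?w \<in> lp_ball p"
      proof -
        have "(\<Sum>k<L. cmod (?w k) powr p) \<le> 1" for L
        proof -
          have "(\<Sum>k<L. cmod (?w k) powr p) = (\<Sum>k=K..<L. cmod (?w k) powr p)"
            by (rule sum.mono_neutral_right) auto
          also have "\<dots> = (\<Sum>k=K..<L. cmod (y k) powr p) / \<epsilon> powr p"
            using \<epsilon> by (simp add: norm_divide powr_divide flip: sum_divide_distrib)
          also have "\<dots> \<le> 1"
            using K0[OF K, of L] \<epsilon> by (simp add: divide_le_eq)
          finally show ?thesis .
        qed
        then show ?thesis using p0 by (simp add: lp_ball_iff)
      qed
      have "?t K = (\<lambda>k. 1 * y k + (- of_real \<epsilon>) * ?w k)"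
        using \<epsilon> by auto
      then have "T (?t K) = T y - of_real \<epsilon> * T ?w"
        using lp_functional_comb[OF T y lp_ball_in_ell[OF w], of 1 "- of_real \<epsilon>"] by simp
      then have "dist (T (?t K)) (T y) = \<epsilon> * cmod (T ?w)"
        using \<epsilon> by (simp add: dist_norm norm_mult)
      also have "\<dots> \<le> \<epsilon> * C" using C[OF w] \<epsilon> by simp
      also have "\<dots> < \<epsilon> * (\<bar>C\<bar> + 1)" using \<epsilon> by simp
      also have "\<dots> = r" by (simp add: \<epsilon>_def)
      finally show ?thesis .
    qed
    then show ?thesis by blast
  qed
  then show ?thesis by (simp add: lim_sequentially)
qed

section \<open>Unit sequences and pointwise limits of functionals\<close>

definition unit_seq :: "nat \<Rightarrow> nat \<Rightarrow> complex" where
  "unit_seq k = (\<lambda>j. if j = k then 1 else 0)"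

lemma unit_seq_in_lp_ball:
  assumes "0 < p"
  shows "unit_seq k \<in> lp_ball p"
proof -
  have "(\<Sum>j<K. cmod (unit_seq k j) powr p) \<le> 1" for K
  proof -
    have "(\<Sum>j<K. cmod (unit_seq k j) powr p) = (\<Sum>j<K. if j = k then 1 else 0)"
      by (intro sum.cong) (auto simp: unit_seq_def)
    then show ?thesis by simp
  qed
  then show ?thesis using assms by (simp add: lp_ball_iff)
qed

lemma unit_seq_in_ell: "0 < p \<Longrightarrow> unit_seq k \<in> ell (ennreal p)"
  by (intro lp_ball_in_ell unit_seq_in_lp_ball)

lemma lp_functional_trunc:
  assumes p: "1 \<le> p" and T: "lp_functional p T"
  shows "T (\<lambda>k. if k < K then y k else 0) = (\<Sum>k<K. T (unit_seq k) * y k)"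
proof -
  have u: "unit_seq k \<in> ell (ennreal p)" for k
    using p by (intro unit_seq_in_ell) simp
  \<comment> \<open>Membership is carried through the induction because linearity is available only
    on the space.\<close>
  have "(\<lambda>k. if k < K then y k else 0) \<in> ell (ennreal p)
     \<and> T (\<lambda>k. if k < K then y k else 0) = (\<Sum>k<K. T (unit_seq k) * y k)"
  proof (induction K)
    case 0
    have "(\<lambda>_. 0) \<in> ell (ennreal p)" "T (\<lambda>_. 0) = 0"
      using ell_comb[OF p u u, of 0 0 0 0] lp_functional_scale[OF T u, of 0 0] by simp_all
    then show ?case by simp
  next
    case (Suc K)
    have "(\<lambda>k. if k < Suc K then y k else 0)
        = (\<lambda>k. 1 * (if k < K then y k else 0) + y K * unit_seq K k)"
      by (auto simp: fun_eq_iff unit_seq_def less_Suc_eq)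
    then show ?case
      using Suc ell_comb[OF p _ u, of _ 1 "y K"] lp_functional_comb[OF T _ u, of _ 1 "y K"]
      by simp
  qed
  then show ?thesis by blast
qed

text \<open>Banach-Steinhaus: convergence bounds the values at each point, uniform boundedness gives
  one bound on the ball, and it survives the limit.\<close>

lemma lp_functional_LIMSEQ:
  assumes p: "1 \<le> p" and F: "\<And>m. lp_functional p (F m)"
    and lim: "\<And>y. y \<in> ell (ennreal p) \<Longrightarrow> (\<lambda>m. F m y) \<longlonglongrightarrow> T y"
  shows "lp_functional p T"
  unfolding lp_functional_def
proof (intro conjI ballI allI)
  fix x y a b
  assume x: "x \<in> ell (ennreal p)" and y: "y \<in> ell (ennreal p)"
  have "(\<lambda>m. F m (\<lambda>k. a * x k + b * y k)) \<longlonglongrightarrow> a * T x + b * T y"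
    unfolding lp_functional_comb[OF F x y] by (intro tendsto_intros lim x y)
  then show "T (\<lambda>k. a * x k + b * y k) = a * T x + b * T y"
    using lim[OF ell_comb[OF p x y]] LIMSEQ_unique by blast
next
  have "\<exists>C. \<forall>m\<in>UNIV. cmod (F m y) \<le> C" if "y \<in> lp_ball p" for y
    using convergent_imp_Bseq[OF convergentI[OF lim[OF lp_ball_in_ell[OF that]]]]
    unfolding Bseq_def by blast
  then obtain C where C: "\<And>m y. y \<in> lp_ball p \<Longrightarrow> cmod (F m y) \<le> C"
    using lp_uniform_boundedness[of p UNIV F] p F by blast
  have "cmod (T y) \<le> C" if "y \<in> lp_ball p" for y
  proof (rule LIMSEQ_le_const2)
    show "(\<lambda>m. cmod (F m y)) \<longlonglongrightarrow> cmod (T y)"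
      by (intro tendsto_norm lim lp_ball_in_ell that)
  qed (use C[OF that] in blast)
  then show "\<exists>C. \<forall>y\<in>lp_ball p. cmod (T y) \<le> C" by blast
qed

section \<open>Duality\<close>

text \<open>Brings conjugacy from \<open>ennreal\<close> to the reals: \<open>q = 0\<close> would
  make \<open>1 / q\<close> infinite, and \<open>q = \<infinity>\<close> makes it zero, which forces
  \<open>p = 1\<close>.\<close>

lemma conjugate_exponent_cases:
  fixes q :: ennreal
  assumes "1 \<le> p" "1 / ennreal p + 1 / q = 1"
  obtains "p = 1" "q = \<infinity>"
    | r where "1 < p" "1 < r" "q = ennreal r" "1 / p + 1 / r = 1"
proof (cases "p = 1")
  case True
  then have "1 + 1 / q = 1 + 0" using assms by simp
  then have "1 / q = 0" by (simp only: ennreal_add_left_cancel) simp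
  then have "q = \<infinity>" by (simp add: ennreal_divide_eq_0_iff)
  with True show ?thesis using that(1) by blast
next
  case False
  then have p: "1 < p" using assms by simp
  have inv_p: "1 / ennreal p = ennreal (1 / p)"
    using p by (simp add: divide_ennreal flip: ennreal_1)
  show ?thesis
  proof (cases q)
    case (real s)
    have "s \<noteq> 0"
    proof
      assume "s = 0"
      then have "1 / q = \<infinity>" using real by (simp add: ennreal_divide_eq_top_iff)
      then show False using assms(2) by simp
    qed
    then have s: "0 < s" using real by simp
    have "1 / q = ennreal (1 / s)"
      using s real by (simp add: divide_ennreal flip: ennreal_1)
    then have "ennreal (1 / p + 1 / s) = ennreal 1"
      using assms(2) inv_p p s by (simp add: ennreal_plus)
    then have eq: "1 / p + 1 / s = 1"
      using p s by (subst (asm) ennreal_inj) auto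
    moreover have "1 / p > 0" using p by simp
    ultimately have "1 / s < 1" by linarith
    then have "1 < s" using s by simp
    then show ?thesis using that(2) p real eq by blast
  next
    case top
    then have "ennreal (1 / p) = ennreal 1" using assms(2) inv_p by simp
    then have "1 / p = 1" using p by (subst (asm) ennreal_inj) auto
    then show ?thesis using p by simp
  qed
qed

text \<open>\<open>D\<close> is perturbed to \<open>d > D\<close> because Young's inequality needs a positive scaling factor.\<close>
lemma Holder_finite_le:
  fixes b y :: "nat \<Rightarrow> complex"
  assumes pr: "1 < p" "1 < r" "1 / p + 1 / r = 1" and D: "0 \<le> D"
    and b: "(\<Sum>k<K. cmod (b k) powr r) \<le> D powr r"
    and y: "(\<Sum>k<K. cmod (y k) powr p) \<le> 1"
  shows "cmod (\<Sum>k<K. b k * y k) \<le> D"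
proof (rule dense_ge)
  fix d assume "D < d"
  then have d: "0 < d" using D by simp
  \<comment> \<open>After division of \<open>b\<close> by \<open>d\<close> both power sums are at
    most one, so Young's inequality sums up to \<open>1 / r + 1 / p\<close>.\<close>
  have "(\<Sum>k<K. cmod (b k) / d * cmod (y k))
      \<le> (\<Sum>k<K. (cmod (b k) / d) powr r / r + cmod (y k) powr p / p)"
    using pr d by (intro sum_mono Youngs_inequality) (auto simp: add.commute)
  also have "\<dots> = (\<Sum>k<K. cmod (b k) powr r) / d powr r / r + (\<Sum>k<K. cmod (y k) powr p) / p"
    using d by (simp add: sum.distrib powr_divide sum_divide_distrib)
  also have "(\<Sum>k<K. cmod (b k) powr r) / d powr r \<le> 1"
    using b powr_mono2[of r D d] \<open>D < d\<close> D d pr by (simp add: divide_le_eq_1)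
  then have "(\<Sum>k<K. cmod (b k) powr r) / d powr r / r + (\<Sum>k<K. cmod (y k) powr p) / p
      \<le> 1 / r + 1 / p"
    using y pr by (intro add_mono divide_right_mono) auto
  finally have "(\<Sum>k<K. cmod (b k) * cmod (y k)) / d \<le> 1"
    using pr by (simp add: sum_divide_distrib add.commute)
  then have "(\<Sum>k<K. cmod (b k * y k)) \<le> d"
    using d by (simp add: divide_le_eq norm_mult)
  then show "cmod (\<Sum>k<K. b k * y k) \<le> d"
    by (rule order_trans[OF norm_sum])
qed

text \<open>The equality case of Hoelder's inequality, which shows that the dual bound is attained
  on finite sections.\<close>

lemma Holder_extremal:
  fixes b :: "nat \<Rightarrow> complex"
  assumes pr: "1 < p" "1 < r" "1 / p + 1 / r = 1"
  obtains y where "y \<in> lp_ball p"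
    "(\<Sum>k<K. b k * y k) = of_real ((\<Sum>k<K. cmod (b k) powr r) powr (1 / r))"
proof -
  define S where "S = (\<Sum>k<K. cmod (b k) powr r)"
  have S0: "0 \<le> S" unfolding S_def by (intro sum_nonneg) auto
  have rp: "(r - 1) * p = r" using pr by (simp add: field_simps)
  \<comment> \<open>The conjugate sign cancels the phase of \<open>b k\<close>, and the exponent
    fits as \<open>(r - 1) * p = r\<close>. For \<open>S = 0\<close> the convention
    \<open>0 powr t = 0\<close> makes \<open>y\<close> zero, and both sides of the claim
    vanish.\<close>
  define y where "y = (\<lambda>k. if k < K then
      cnj (sgn (b k)) * of_real (cmod (b k) powr (r - 1) * S powr (- (1 / p))) else 0)"
  show ?thesis
  proof (rule that)
    have norm_y: "cmod (y k) powr p \<le> (if k < K then cmod (b k) powr r / S else 0)" for k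
    proof (cases "k < K")
      case True
      have "cmod (y k) powr p \<le> (cmod (b k) powr (r - 1) * S powr (- (1 / p))) powr p"
        using True pr by (intro powr_mono2) (auto simp: y_def norm_mult norm_sgn)
      also have "\<dots> = cmod (b k) powr r / S"
        using pr S0 by (simp add: powr_mult powr_divide powr_powr rp powr_minus_divide)
      finally show ?thesis using True by simp
    next
      case False
      then show ?thesis by (simp add: y_def)
    qed
    have "(\<Sum>k<L. cmod (y k) powr p) \<le> 1" for L
    proof -
      have "(\<Sum>k<L. cmod (y k) powr p) \<le> (\<Sum>k<L. if k < K then cmod (b k) powr r / S else 0)"
        by (intro sum_mono norm_y)
      also have "\<dots> = (\<Sum>k\<in>{..<L} \<inter> {..<K}. cmod (b k) powr r / S)"
        by (simp add: sum.inter_restrict)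
      also have "\<dots> \<le> (\<Sum>k<K. cmod (b k) powr r / S)"
        using S0 by (intro sum_mono2) auto
      also have "\<dots> = S / S" unfolding S_def by (rule sum_divide_distrib[symmetric])
      also have "\<dots> \<le> 1" by simp
      finally show ?thesis .
    qed
    then show "y \<in> lp_ball p" using pr by (simp add: lp_ball_iff)
    have prod: "b k * y k = of_real (cmod (b k) powr r * S powr (- (1 / p)))" if "k < K" for k
    proof (cases "b k = 0")
      case False
      have "b k * cnj (sgn (b k)) = of_real (cmod (b k))"
        using False
        by (simp add: sgn_eq power2_eq_square flip: complex_norm_square)
      moreover have "b k * y k = b k * cnj (sgn (b k)) *
          of_real (cmod (b k) powr (r - 1) * S powr (- (1 / p)))"
        using that by (simp only: y_def if_True mult.assoc)
      ultimately have "b k * y k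
          = of_real (cmod (b k) * cmod (b k) powr (r - 1) * S powr (- (1 / p)))"
        by (simp only: of_real_mult mult.assoc)
      also have "cmod (b k) * cmod (b k) powr (r - 1) = cmod (b k) powr r"
        using False by (simp add: powr_mult_base)
      finally show ?thesis .
    qed simp
    have "(\<Sum>k<K. b k * y k) = of_real (S * S powr (- (1 / p)))"
      using prod by (simp add: S_def sum_distrib_right)
    also have "S * S powr (- (1 / p)) = S powr (1 / r)"
    proof -
      have "1 / r = 1 + - (1 / p)" using pr by simp
      then show ?thesis using S0 by (simp only: powr_mult_base)
    qed
    finally show "(\<Sum>k<K. b k * y k) = of_real ((\<Sum>k<K. cmod (b k) powr r) powr (1 / r))"
      by (simp add: S_def)
  qed
qed

text \<open>The dual description of the norm through finite pairings, free of convergence questions.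
  For \<open>p = 1\<close> the unit sequences are the test vectors, otherwise the extremal
  ones.\<close>

lemma ell_norm_le_iff_pairing:
  fixes q :: ennreal
  assumes p: "1 \<le> p" and q: "1 / ennreal p + 1 / q = 1" and D: "0 \<le> D"
  shows "ell_norm q b \<le> ennreal D
    \<longleftrightarrow> (\<forall>y\<in>lp_ball p. \<forall>K. cmod (\<Sum>k<K. b k * y k) \<le> D)"
  using p q
proof (cases rule: conjugate_exponent_cases)
  case 1
  have "ell_norm q b \<le> ennreal D \<longleftrightarrow> (\<forall>k. cmod (b k) \<le> D)"
    using D by (simp add: 1 ell_norm_def SUP_le_iff)
  moreover have "cmod (\<Sum>k<K. b k * y k) \<le> D"
    if b: "\<forall>k. cmod (b k) \<le> D" and y: "y \<in> lp_ball p" for y K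
  proof -
    have "cmod (\<Sum>k<K. b k * y k) \<le> (\<Sum>k<K. D * cmod (y k))"
      using b by (intro sum_norm_le) (auto simp: norm_mult intro: mult_right_mono)
    also have "\<dots> = D * (\<Sum>k<K. cmod (y k))" by (simp add: sum_distrib_left)
    also have "\<dots> \<le> D * 1"
      using y D 1 lp_ball_iff[of 1 y] by (intro mult_left_mono) auto
    finally show ?thesis by simp
  qed
  moreover have "cmod (b k) \<le> D"
    if *: "\<forall>y\<in>lp_ball p. \<forall>K. cmod (\<Sum>k<K. b k * y k) \<le> D" for k
  proof -
    have "(\<Sum>j<Suc k. b j * unit_seq k j) = b k"
      by (simp add: unit_seq_def)
    then show ?thesis using * unit_seq_in_lp_ball[of p k] p by (metis less_le_trans zero_less_one)
  qed
  ultimately show ?thesis by blast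
next
  case (2 r)
  have r: "0 < r" using 2 by simp
  have "ell_norm q b \<le> ennreal D \<longleftrightarrow> (\<forall>K. (\<Sum>k<K. cmod (b k) powr r) \<le> D powr r)"
    unfolding 2 by (rule ell_norm_le_iff[OF r D])
  moreover have "cmod (\<Sum>k<K. b k * y k) \<le> D"
    if b: "\<forall>K. (\<Sum>k<K. cmod (b k) powr r) \<le> D powr r" and y: "y \<in> lp_ball p" for y K
    using Holder_finite_le[OF 2(1,2,4) D] b y lp_ball_iff[of p y] p by simp
  moreover have "(\<Sum>k<K. cmod (b k) powr r) \<le> D powr r"
    if *: "\<forall>y\<in>lp_ball p. \<forall>K. cmod (\<Sum>k<K. b k * y k) \<le> D" for K
  proof -
    let ?S = "\<Sum>k<K. cmod (b k) powr r"
    have S0: "0 \<le> ?S" by (intro sum_nonneg) auto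
    obtain y where y: "y \<in> lp_ball p" "(\<Sum>k<K. b k * y k) = of_real (?S powr (1 / r))"
      by (rule Holder_extremal[OF 2(1,2,4), where K = K and b = b])
    have "?S powr (1 / r) \<le> D" using *[rule_format, OF y(1), of K] unfolding y(2) by simp
    then have "(?S powr (1 / r)) powr r \<le> D powr r"
      using r by (intro powr_mono2) auto
    then show ?thesis using r S0 by (simp add: powr_powr)
  qed
  ultimately show ?thesis by blast
qed

text \<open>Truncations remain in the ball and converge under \<open>T\<close>, so bounds on finite
  pairings and bounds on \<open>T\<close> are the same. Comparing bounds \<open>D\<close> avoids
  introducing a dual norm.\<close>

lemma ell_norm_functional_le_iff:
  fixes q :: ennreal
  assumes p: "1 \<le> p" and q: "1 / ennreal p + 1 / q = 1" and D: "0 \<le> D"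
    and T: "lp_functional p T"
  shows "ell_norm q (\<lambda>k. T (unit_seq k)) \<le> ennreal D \<longleftrightarrow> (\<forall>y\<in>lp_ball p. cmod (T y) \<le> D)"
  unfolding ell_norm_le_iff_pairing[OF p q D]
proof safe
  fix y
  assume *: "\<forall>y\<in>lp_ball p. \<forall>K. cmod (\<Sum>k<K. T (unit_seq k) * y k) \<le> D" and y: "y \<in> lp_ball p"
  show "cmod (T y) \<le> D"
  proof (rule LIMSEQ_le_const2)
    show "(\<lambda>K. cmod (\<Sum>k<K. T (unit_seq k) * y k)) \<longlonglongrightarrow> cmod (T y)"
      using lp_functional_trunc_LIMSEQ[OF p T lp_ball_in_ell[OF y]]
      unfolding lp_functional_trunc[OF p T] by (rule tendsto_norm)
  qed (use * y in blast)
next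
  fix y K
  assume *: "\<forall>y\<in>lp_ball p. cmod (T y) \<le> D" and y: "y \<in> lp_ball p"
  have "(\<lambda>k. if k < K then y k else 0) \<in> lp_ball p"
    by (rule lp_ball_mono[OF _ y]) (use p in auto)
  then show "cmod (\<Sum>k<K. T (unit_seq k) * y k) \<le> D"
    using * unfolding lp_functional_trunc[OF p T, symmetric] by blast
qed

text \<open>The constant is two coordinates times two signs: each of the four parts is a coordinate
  of a subsum, hence at most \<open>D\<close>.\<close>

lemma sum_cmod_le_4:
  fixes c :: "nat \<Rightarrow> complex"
  assumes fin: "finite M" and D: "\<And>N. N \<subseteq> M \<Longrightarrow> cmod (\<Sum>n\<in>N. c n) \<le> D"
  shows "(\<Sum>n\<in>M. cmod (c n)) \<le> 4 * D"
proof -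
  have abs_le: "(\<Sum>n\<in>M. \<bar>f (c n)\<bar>) \<le> 2 * D"
    if f: "\<And>N. f (\<Sum>n\<in>N. c n) = (\<Sum>n\<in>N. f (c n))" "\<And>z. \<bar>f z\<bar> \<le> cmod z"
    for f :: "complex \<Rightarrow> real"
  proof -
    let ?P = "{n\<in>M. 0 \<le> f (c n)}" and ?N = "{n\<in>M. \<not> 0 \<le> f (c n)}"
    have part: "\<bar>\<Sum>n\<in>N. f (c n)\<bar> \<le> D" if "N \<subseteq> M" for N
      using f(2)[of "\<Sum>n\<in>N. c n"] D[OF that] by (simp add: f(1))
    have "(\<Sum>n\<in>M. \<bar>f (c n)\<bar>) = (\<Sum>n\<in>?P. \<bar>f (c n)\<bar>) + (\<Sum>n\<in>?N. \<bar>f (c n)\<bar>)"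
      using fin by (subst sum.union_disjoint[symmetric]) (auto intro: sum.cong)
    also have "\<dots> = (\<Sum>n\<in>?P. f (c n)) - (\<Sum>n\<in>?N. f (c n))"
      by (simp flip: sum_negf)
    also have "\<dots> \<le> D + D"
      using part[of ?P] part[of ?N] by force
    finally show ?thesis by simp
  qed
  have "(\<Sum>n\<in>M. cmod (c n)) \<le> (\<Sum>n\<in>M. \<bar>Re (c n)\<bar> + \<bar>Im (c n)\<bar>)"
    by (intro sum_mono cmod_le)
  also have "\<dots> \<le> 2 * D + 2 * D"
    unfolding sum.distrib by (intro add_mono abs_le abs_Re_le_cmod abs_Im_le_cmod Re_sum Im_sum)
  finally show ?thesis by simp
qed

section \<open>Fractional differences\<close>

text \<open>Non-integrality keeps \<open>\<alpha> + 1\<close> off the poles of Gamma.\<close>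

lemma frac_coeff_eq_gbinomial:
  assumes "\<alpha> \<notin> \<int>"
  shows "frac_coeff \<alpha> i = (-1) ^ i * (\<alpha> gchoose i)"
proof -
  have "\<alpha> + 1 \<notin> \<int>\<^sub>\<le>\<^sub>0"
    using assms by (metis Ints_1 Ints_diff add_diff_cancel_right' nonpos_Ints_Int)
  then show ?thesis by (simp add: frac_coeff_def gbinomial_Gamma)
qed

text \<open>Coefficient form of the identity that the binomial series of \<open>(1 - t)\<close> to
  the powers \<open>\<alpha>\<close> and \<open>- \<alpha>\<close> multiply to 1.\<close>

lemma frac_coeff_convolution:
  assumes "\<alpha> \<notin> \<int>"
  shows "(\<Sum>i\<le>m. frac_coeff \<alpha> i * frac_coeff (- \<alpha>) (m - i)) = (if m = 0 then 1 else 0)"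
proof -
  have "(\<Sum>i\<le>m. frac_coeff \<alpha> i * frac_coeff (- \<alpha>) (m - i))
      = (\<Sum>i\<le>m. (-1) ^ m * ((\<alpha> gchoose i) * ((- \<alpha>) gchoose (m - i))))"
  proof (rule sum.cong)
    fix i assume "i \<in> {..m}"
    then have "(-1) ^ m = (-1) ^ i * (-1 :: real) ^ (m - i)"
      by (simp flip: power_add)
    then show "frac_coeff \<alpha> i * frac_coeff (- \<alpha>) (m - i)
        = (-1) ^ m * ((\<alpha> gchoose i) * ((- \<alpha>) gchoose (m - i)))"
      using assms by (simp add: frac_coeff_eq_gbinomial minus_in_Ints_iff)
  qed simp
  also have "\<dots> = (-1) ^ m * ((\<alpha> + - \<alpha>) gchoose m)"
    by (simp add: gbinomial_Vandermonde atMost_atLeast0 flip: sum_distrib_left)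
  also have "\<dots> = (if m = 0 then 1 else 0)"
    by (cases m) (simp_all add: gbinomial_0_left)
  finally show ?thesis .
qed

text \<open>The hypothesis is symmetric under \<open>\<alpha>\<close> to \<open>- \<alpha>\<close>,
  so this one lemma yields a two-sided inverse.\<close>

lemma frac_diff_inverse:
  assumes "\<alpha> \<notin> \<int>"
  shows "frac_diff \<alpha> (frac_diff (- \<alpha>) y) = y"
proof
  fix k
  let ?a = "\<lambda>i. of_real (frac_coeff \<alpha> i) :: complex"
  let ?b = "\<lambda>i. of_real (frac_coeff (- \<alpha>) i) :: complex"
  have "frac_diff \<alpha> (frac_diff (- \<alpha>) y) k = (\<Sum>i\<le>k. \<Sum>j\<le>k - i. ?a i * ?b j * y (k - (i + j)))"
    by (simp add: frac_diff_def sum_distrib_left mult.assoc)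
  also have "\<dots> = (\<Sum>(i, j)\<in>{(i, j). i + j \<le> k}. ?a i * ?b j * y (k - (i + j)))"
    by (subst sum.Sigma) (auto intro!: sum.cong)
  \<comment> \<open>Summing along the diagonals \<open>i + j = m\<close> exposes the
    convolution.\<close>
  also have "\<dots> = (\<Sum>m\<le>k. \<Sum>i\<le>m. ?a i * ?b (m - i) * y (k - (i + (m - i))))"
    by (rule sum.triangle_reindex_eq)
  also have "\<dots> = (\<Sum>m\<le>k. of_real (\<Sum>i\<le>m. frac_coeff \<alpha> i * frac_coeff (- \<alpha>) (m - i)) * y (k - m))"
    by (simp add: sum_distrib_right)
  also have "\<dots> = (\<Sum>m\<le>k. if m = 0 then y k else 0)"
    by (intro sum.cong) (auto simp: frac_coeff_convolution[OF assms])
  also have "\<dots> = y k" by simp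
  finally show "frac_diff \<alpha> (frac_diff (- \<alpha>) y) k = y k" .
qed

lemma frac_diff_unit_seq:
  "frac_diff \<beta> (unit_seq k) j = (if k \<le> j then of_real (frac_coeff \<beta> (j - k)) else 0)"
proof (cases "k \<le> j")
  case True
  have "frac_diff \<beta> (unit_seq k) j
      = (\<Sum>i\<le>j. if i = j - k then of_real (frac_coeff \<beta> i) else 0)"
    unfolding frac_diff_def unit_seq_def using True by (intro sum.cong) auto
  then show ?thesis using True by simp
next
  case False
  then show ?thesis unfolding frac_diff_def unit_seq_def by (auto intro!: sum.neutral)
qed

text \<open>Identifies \<open>hat_mat\<close> as the matrix acting on the differences. The first
  \<open>k\<close> terms of the series vanish, which accounts for the index shift.\<close>

lemma mat_app_frac_diff_unit_seq:
  assumes "summable (\<lambda>j. A n j * frac_diff (- \<alpha>) (unit_seq k) j)"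
  shows "mat_app A (frac_diff (- \<alpha>) (unit_seq k)) n = hat_mat \<alpha> A n k"
proof -
  have "(\<Sum>j<k. A n j * frac_diff (- \<alpha>) (unit_seq k) j) = 0"
    by (intro sum.neutral) (auto simp: frac_diff_unit_seq)
  then show ?thesis
    unfolding mat_app_def suminf_split_initial_segment[OF assms, of k] hat_mat_def
    by (simp add: frac_diff_unit_seq mult.commute add.commute)
qed

section \<open>The estimates for the operator norm\<close>

lemma ell_norm_1_le_iff:
  assumes "0 \<le> c"
  shows "ell_norm 1 y \<le> ennreal c \<longleftrightarrow> (\<forall>K. (\<Sum>k<K. cmod (y k)) \<le> c)"
  using ell_norm_le_iff[of 1 c y] assms by simp

lemma frac_diff_lp_functional: "0 < p \<Longrightarrow> lp_functional p (\<lambda>y. frac_diff \<beta> y j)"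
  unfolding frac_diff_def by (intro lp_functional_sum lp_functional_cmult lp_functional_coord)

text \<open>Turns a value on the unit ball into a quotient of \<open>op_norm\<close>; at
  \<open>b = 0\<close> it rests on \<open>inverse 0\<close> being infinite.\<close>

lemma ennreal_le_divide_self:
  fixes a b :: ennreal
  assumes "b \<le> 1"
  shows "a \<le> a / b"
proof -
  have "1 \<le> inverse b"
  proof (cases b)
    case (real r)
    then show ?thesis
      using assms by (cases "r = 0") (auto simp: inverse_ennreal field_simps simp flip: ennreal_1)
  qed (use assms in \<open>simp add: top_unique\<close>)
  then have "a * 1 \<le> a * inverse b" by (intro mult_left_mono) auto
  then show ?thesis by (simp add: divide_ennreal_def)
qed

theorem theorem2p10:
  fixes \<alpha> p :: real and q :: ennreal and A :: "nat \<Rightarrow> nat \<Rightarrow> complex"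
  assumes "\<alpha> \<notin> \<int>"
    and "1 \<le> p"
    and "1 / ennreal p + 1 / q = 1"
    and "A \<in> mat_class (ell_diff \<alpha> (ennreal p)) (ell 1)"
  shows "diff_mat_norm \<alpha> q A
           \<le> op_norm (ell_diff \<alpha> (ennreal p)) (ell_diff_norm \<alpha> (ennreal p)) (ell_norm 1) (mat_app A)
       \<and> op_norm (ell_diff \<alpha> (ennreal p)) (ell_diff_norm \<alpha> (ennreal p)) (ell_norm 1) (mat_app A)
           \<le> 4 * diff_mat_norm \<alpha> q A
       \<and> diff_mat_norm \<alpha> q A < \<infinity>"
proof -
  note p = assms(2) and q = assms(3)
  have p0: "0 < p" using p by simp
  have inv1: "frac_diff \<alpha> (frac_diff (- \<alpha>) y) = y" for y
    by (rule frac_diff_inverse[OF assms(1)])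
  have inv2: "frac_diff (- \<alpha>) (frac_diff \<alpha> x) = x" for x
    using frac_diff_inverse[of "- \<alpha>" x] assms(1) by (simp add: minus_in_Ints_iff)
  let ?X = "ell_diff \<alpha> (ennreal p)"
  define B where "B = (\<lambda>y. mat_app A (frac_diff (- \<alpha>) y))"
  have in_X: "frac_diff (- \<alpha>) y \<in> ?X" if "y \<in> ell (ennreal p)" for y
    using that by (simp add: ell_diff_def inv1)
  have summ: "summable (\<lambda>k. A n k * frac_diff (- \<alpha>) y k)" if "y \<in> ell (ennreal p)" for y n
    using in_X[OF that] assms(4) by (auto simp: mat_class_def)
  have B_ell: "B y \<in> ell 1" if "y \<in> ell (ennreal p)" for y
    using in_X[OF that] assms(4) by (auto simp: mat_class_def B_def)
  \<comment> \<open>Each row is the pointwise limit of its partial sums, finite combinations of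
    coordinates, so its continuity is automatic.\<close>
  have B_functional: "lp_functional p (\<lambda>y. B y n)" for n
  proof (rule lp_functional_LIMSEQ[OF p])
    show "lp_functional p (\<lambda>y. \<Sum>j<m. A n j * frac_diff (- \<alpha>) y j)" for m
      using p0 by (intro lp_functional_sum lp_functional_cmult frac_diff_lp_functional)
    show "(\<lambda>m. \<Sum>j<m. A n j * frac_diff (- \<alpha>) y j) \<longlonglongrightarrow> B y n" if "y \<in> ell (ennreal p)" for y
      unfolding B_def mat_app_def by (intro summable_LIMSEQ summ that)
  qed
  define T where "T = (\<lambda>N y. \<Sum>n\<in>N. B y n)"
  have T: "lp_functional p (T N)" for N
    unfolding T_def by (intro lp_functional_sum B_functional)
  have T_unit: "T N (unit_seq k) = (\<Sum>n\<in>N. hat_mat \<alpha> A n k)" for N k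
    unfolding T_def B_def
    by (intro sum.cong mat_app_frac_diff_unit_seq summ unit_seq_in_ell p0 refl)
  have T_le: "cmod (T N y) \<le> c" if N: "finite N" and le: "ell_norm 1 (B y) \<le> ennreal c" and c: "0 \<le> c"
    for N y c
  proof -
    obtain K where K: "N \<subseteq> {..<K}"
      using finite_nat_bounded[OF N] by blast
    have "cmod (T N y) \<le> (\<Sum>n\<in>N. cmod (B y n))" unfolding T_def by (rule norm_sum)
    also have "\<dots> \<le> (\<Sum>n<K. cmod (B y n))" using K by (intro sum_mono2) auto
    also have "\<dots> \<le> c" using le unfolding ell_norm_1_le_iff[OF c] by blast
    finally show ?thesis .
  qed
  let ?F = "{N :: nat set. finite N \<and> N \<noteq> {}}"
  have le_iff: "diff_mat_norm \<alpha> q A \<le> ennreal D \<longleftrightarrow> (\<forall>N\<in>?F. \<forall>y\<in>lp_ball p. cmod (T N y) \<le> D)"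
    if "0 \<le> D" for D
    unfolding diff_mat_norm_def SUP_le_iff T_unit[symmetric]
      ell_norm_functional_le_iff[OF p q that T] ..
  have finite_norm: "diff_mat_norm \<alpha> q A < \<infinity>"
  proof -
    have "\<exists>C. \<forall>N\<in>?F. cmod (T N y) \<le> C" if y: "y \<in> lp_ball p" for y
    proof -
      have "ell_norm 1 (B y) < \<infinity>" using B_ell[OF lp_ball_in_ell[OF y]] by (simp add: ell_def)
      then obtain c where c: "0 \<le> c" "ell_norm 1 (B y) = ennreal c"
        by (cases "ell_norm 1 (B y)") auto
      then show ?thesis by (intro exI[of _ c] ballI T_le) auto
    qed
    then obtain C where C: "\<forall>N\<in>?F. \<forall>y\<in>lp_ball p. cmod (T N y) \<le> C"
      using lp_uniform_boundedness[OF p, of ?F T] T by blast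
    \<comment> \<open>\<open>le_iff\<close> asks for a nonnegative bound, hence the absolute
      value.\<close>
    then have "\<forall>N\<in>?F. \<forall>y\<in>lp_ball p. cmod (T N y) \<le> \<bar>C\<bar>"
      by (meson abs_ge_self order_trans)
    then have "diff_mat_norm \<alpha> q A \<le> ennreal \<bar>C\<bar>"
      by (simp only: le_iff[OF abs_ge_zero])
    then show ?thesis by (simp add: order_le_less_trans)
  qed
  let ?op = "op_norm ?X (ell_diff_norm \<alpha> (ennreal p)) (ell_norm 1) (mat_app A)"
  have lower: "diff_mat_norm \<alpha> q A \<le> ?op"
  proof (cases ?op)
    case (real D)
    have "cmod (T N y) \<le> D" if N: "finite N" and y: "y \<in> lp_ball p" for N y
    proof (rule T_le[OF N])
      let ?x = "frac_diff (- \<alpha>) y"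
      show "ell_norm 1 (B y) \<le> ennreal D"
      \<comment> \<open>The zero sequence is excluded from the supremum in \<open>op_norm\<close>
        and is treated by hand.\<close>
      proof (cases "?x = (\<lambda>_. 0)")
        case True
        then have "B y = (\<lambda>_. 0)" by (simp add: B_def mat_app_def fun_eq_iff)
        then show ?thesis using real by (simp add: ell_norm_1_le_iff)
      next
        case False
        have "ell_norm 1 (B y) \<le> ell_norm 1 (B y) / ell_norm (ennreal p) y"
          using y by (intro ennreal_le_divide_self) (simp add: lp_ball_def)
        also have "\<dots> = ell_norm 1 (mat_app A ?x) / ell_diff_norm \<alpha> (ennreal p) ?x"
          by (simp add: B_def ell_diff_norm_def inv1)
        also have "\<dots> \<le> ?op"
          unfolding op_norm_def using False in_X[OF lp_ball_in_ell[OF y]]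
          by (intro SUP_upper) auto
        finally show ?thesis using real by simp
      qed
    qed (use real in auto)
    then show ?thesis unfolding real(2) le_iff[OF real(1)] by blast
  qed simp
  have upper: "?op \<le> 4 * diff_mat_norm \<alpha> q A"
  proof -
    obtain d where d: "0 \<le> d" "diff_mat_norm \<alpha> q A = ennreal d"
      using finite_norm by (cases "diff_mat_norm \<alpha> q A") auto
    have T_ball: "cmod (T N y) \<le> d" if "finite N" "y \<in> lp_ball p" for N y
    \<comment> \<open>The supremum runs over nonempty sets, whereas \<open>sum_cmod_le_4\<close>
      also tests the empty one.\<close>
    proof (cases "N = {}")
      case True
      then show ?thesis using d by (simp add: T_def)
    next
      case False
      then show ?thesis using le_iff[OF d(1)] d(2) that by auto
    qed
    show ?thesis
      unfolding op_norm_def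
    proof (rule SUP_least)
      fix x assume "x \<in> ?X - {\<lambda>_. 0}"
      then have x: "frac_diff \<alpha> x \<in> ell (ennreal p)" "x \<noteq> (\<lambda>_. 0)" by (auto simp: ell_diff_def)
      define y where "y = frac_diff \<alpha> x"
      have By: "B y = mat_app A x" by (simp add: B_def y_def inv2)
      have y: "y \<in> ell (ennreal p)" using x by (simp add: y_def)
      then obtain c where c: "0 \<le> c" "ell_norm (ennreal p) y = ennreal c"
        by (cases "ell_norm (ennreal p) y") (auto simp: ell_def)
      \<comment> \<open>Definiteness of the norm: if all differences vanish, inverting them gives
        \<open>x = 0\<close>, which was excluded.\<close>
      have "c \<noteq> 0"
      proof
        assume "c = 0"
        then have "ell_norm (ennreal p) y \<le> ennreal 0" using c by simp
        then have *: "(\<Sum>k<K. cmod (y k) powr p) \<le> 0" for K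
          using ell_norm_le_iff[OF p0, of 0 y] by simp
        have "y k = 0" for k
        proof -
          have "cmod (y k) powr p \<le> (\<Sum>j<Suc k. cmod (y j) powr p)"
            by (intro member_le_sum) auto
          then have "cmod (y k) powr p \<le> 0" using * order_trans by blast
          then show ?thesis by simp
        qed
        then have "frac_diff (- \<alpha>) y = (\<lambda>_. 0)" by (simp add: frac_diff_def fun_eq_iff)
        then show False using x(2) by (simp add: y_def inv2)
      qed
      then have c0: "0 < c" using c by simp
      have ball: "(\<lambda>k. y k / of_real c) \<in> lp_ball p"
        using ell_norm_le_iff_scaled[OF p0 c0, of y] c by simp
      have "cmod (T N y) \<le> c * d" if N: "finite N" for N
      proof -
        have "T N y = of_real c * T N (\<lambda>k. y k / of_real c)"
          using lp_functional_scale[OF T lp_ball_in_ell[OF ball], of N "of_real c"] c0 by simp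
        then show ?thesis using T_ball[OF N ball] c0 by (simp add: norm_mult)
      qed
      \<comment> \<open>All subsums over subsets of the initial segment are bounded by
        \<open>c * d\<close>, uniformly in \<open>K\<close>.\<close>
      then have "(\<Sum>n<K. cmod (B y n)) \<le> 4 * (c * d)" for K
        by (intro sum_cmod_le_4) (auto simp: T_def intro: finite_subset)
      then have "ell_norm 1 (B y) \<le> ennreal (4 * (c * d))"
        using c d by (subst ell_norm_1_le_iff) auto
      then have "ell_norm 1 (B y) / ennreal c \<le> ennreal (4 * (c * d)) / ennreal c"
        by (rule divide_right_mono_ennreal)
      also have "\<dots> = ennreal (4 * d)"
        using c0 d by (simp add: divide_ennreal)
      also have "\<dots> = 4 * diff_mat_norm \<alpha> q A"
        using d by (simp add: ennreal_mult)
      finally show "ell_norm 1 (mat_app A x) / ell_diff_norm \<alpha> (ennreal p) x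
          \<le> 4 * diff_mat_norm \<alpha> q A"
        using c(2) by (simp add: ell_diff_norm_def By flip: y_def)
    qed
  qed
  show ?thesis using lower upper finite_norm by blast
qed

end
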